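(* Let $0<\beta<1$, $0<s\le t$, and let $s$ be fixed. Let $\{D_f(t)\}_{t\ge0}$ be a subordinator with $\mathbb{E}[e^{-uD_f(t)}]=e^{-tf(u)}$, where $f$ is its Bernstein function, and with $\mathbb{E}[D_f^\rho(t)]<\infty$ for all $\rho>0$. If $\mathbb{E}[D_f^\beta(t)]\to\infty$ as $t\to\infty$, then, as $t\to\infty$, (i) $\displaystyle \mathbb{E}\left[D_f^\beta(s)D_f^\beta(t)\right]\sim\mathbb{E}\left[D_f^\beta(s)\right]\mathbb{E}\left[D_f^\beta(t-s)\right];$ (ii) $\displaystyle \beta\,\mathbb{E}\left[D_f^{2\beta}(t)\,B\left(\beta,1+\beta;\frac{D_f(s)}{D_f(t)}\right)\right]\sim\mathbb{E}\left[D_f^\beta(s)\right]\mathbb{E}\left[D_f^\beta(t-s)\right].$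
   Context: Notation: $D_f^\rho(t)=(D_f(t))^\rho$; $B(a,b;x)=\int_0^x u^{a-1}(1-u)^{b-1}\,du$ is the incomplete beta function; for positive functions $g,h$, $g(t)\sim h(t)$ as $t\to\infty$ means $\lim_{t\to\infty}g(t)/h(t)=1$. Subordinator: $\{D_f(t)\}_{t\ge 0}$ is a nondecreasing Lévy process with $D_f(0)=0$ a.s. and Laplace exponent the Bernstein function $f(u)=bu+\int_0^\infty(1-e^{-ux})\,\nu(dx)$, with $b\ge0$ and $\nu$ a non-negative Lévy measure on $(0,\infty)$ satisfying $\int_0^\infty (x\wedge1)\,\nu(dx)<\infty$ and $\nu(0,\infty)=\infty$ (so sample paths are a.s. strictly increasing). *)

theory Defs
  imports "HOL-Probability.Probability" "HOL-Library.Landau_Symbols"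
begin

text \<open>
  Real-valued Levy processes indexed by \<open>{0..}\<close>: independent and stationary increments, continuity
  in probability, started at 0. Values of \<open>X\<close> at negative times are irrelevant. No
  path regularity (such as right-continuity) is required, so that processes with cadlag paths are
  covered as well.
\<close>

locale levy_process = prob_space M for M :: "'a measure" +
  fixes X :: "real \<Rightarrow> 'a \<Rightarrow> real"
  assumes random_variable_X: "\<And>t. 0 \<le> t \<Longrightarrow> random_variable borel (X t)"
    and X_0: "AE \<omega> in M. X 0 \<omega> = 0"
    and indep_increments:
      "\<And>(\<tau> :: nat \<Rightarrow> real) n. 0 \<le> \<tau> 0 \<Longrightarrow> (\<And>i. i < n \<Longrightarrow> \<tau> i < \<tau> (Suc i)) \<Longrightarrow>
         indep_vars (\<lambda>_. borel) (\<lambda>i \<omega>. X (\<tau> (Suc i)) \<omega> - X (\<tau> i) \<omega>) {..<n}"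
    and stationary_increments:
      "\<And>t h. 0 \<le> t \<Longrightarrow> 0 \<le> h \<Longrightarrow>
         distr M borel (\<lambda>\<omega>. X (t + h) \<omega> - X t \<omega>) = distr M borel (\<lambda>\<omega>. X h \<omega> - X 0 \<omega>)"
    and stochastically_continuous:
      "\<And>t \<epsilon>. 0 \<le> t \<Longrightarrow> 0 < \<epsilon> \<Longrightarrow>
         ((\<lambda>r. prob {\<omega> \<in> space M. \<epsilon> < \<bar>X r \<omega> - X t \<omega>\<bar>}) \<longlongrightarrow> 0) (at t within {0..})"

text \<open>
  The measure \<open>\<nu>\<close> lives on the open half-line itself: its underlying space is \<open>{0<..}\<close>.
  Its total mass is required to be infinite, which excludes compound Poisson processes with drift.
\<close>

definition subordinator_levy_measure :: "real measure \<Rightarrow> bool" where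
  "subordinator_levy_measure \<nu> \<longleftrightarrow>
     sets \<nu> = sets (restrict_space borel {0<..}) \<and>
     (\<integral>\<^sup>+ x. ennreal (min x 1) \<partial>\<nu>) < \<infinity> \<and>
     emeasure \<nu> {0<..} = \<infinity>"

definition bernstein_of :: "real \<Rightarrow> real measure \<Rightarrow> real \<Rightarrow> real" where
  "bernstein_of b \<nu> u = b * u + (\<integral>x. (1 - exp (- (u * x))) \<partial>\<nu>)"

locale subordinator = levy_process M D for M :: "'a measure" and D +
  fixes f :: "real \<Rightarrow> real"
  assumes nondecreasing: "AE \<omega> in M. \<forall>s t. 0 \<le> s \<and> s \<le> t \<longrightarrow> D s \<omega> \<le> D t \<omega>"
    and bernstein:
      "\<exists>b \<nu>. 0 \<le> b \<and> subordinator_levy_measure \<nu> \<and> (\<forall>u\<ge>0. f u = bernstein_of b \<nu> u)"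
    and laplace:
      "\<And>t u. 0 \<le> t \<Longrightarrow> 0 \<le> u \<Longrightarrow> expectation (\<lambda>\<omega>. exp (- (u * D t \<omega>))) = exp (- (t * f u))"

text \<open>Intended for \<open>0 < a\<close>, \<open>0 < b\<close> and \<open>0 \<le> x \<le> 1\<close>.\<close>

definition incomplete_Beta :: "real \<Rightarrow> real \<Rightarrow> real \<Rightarrow> real" where
  "incomplete_Beta a b x = (LBINT u:{0..x}. u powr (a - 1) * (1 - u) powr (b - 1))"

end

theory Submission
  imports Defs
begin

text \<open>
  Independence and stationarity of the increments turn the common comparison function
  $E[D_s^\beta]\,E[D_{t-s}^\beta]$ into $E[D_s^\beta (D_t - D_s)^\beta]$. On $0 \le u \le x$ the factor
  $(1-u)^\beta$ lies between $(1-x)^\beta$ and $1$; taking $x = D_s/D_t$ gives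
  \[ D_s^\beta (D_t - D_s)^\beta \le \beta D_t^{2\beta} B(\beta, 1+\beta; D_s/D_t) \le D_s^\beta D_t^\beta, \]
  and subadditivity of $y \mapsto y^\beta$ gives
  $D_s^\beta D_t^\beta \le D_s^\beta (D_t - D_s)^\beta + D_s^{2\beta}$. Hence all three expectations
  differ by at most the constant $E[D_s^{2\beta}]$, while the first one tends to infinity: if
  $E[D_s^\beta]$ vanished, then $f(1) = 0$, so $D_t = 0$ almost surely for every $t$.
\<close>

section \<open>Estimates for powers, incomplete Beta integrals and asymptotic equivalence\<close>

lemma powr_add_le_add_powr:
  fixes a b p :: real
  assumes "0 \<le> a" "0 \<le> b" "0 \<le> p" "p \<le> 1"
  shows "(a + b) powr p \<le> a powr p + b powr p"
proof (cases "a = 0 \<or> b = 0")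
  case False
  with assms have ab: "0 < a" "0 < b" by auto
  \<comment> \<open>One factor \<open>a + b\<close> is split off and distributed. The remaining
    exponent \<open>p - 1\<close> is at most 0, so shrinking the base from \<open>a + b\<close> to
    \<open>a\<close> or to \<open>b\<close> only enlarges each term.\<close>
  have "(a + b) powr p = a * (a + b) powr (p - 1) + b * (a + b) powr (p - 1)"
    using ab by (simp add: powr_mult_base flip: distrib_right)
  also have "\<dots> \<le> a * a powr (p - 1) + b * b powr (p - 1)"
    using ab assms by (intro add_mono mult_left_mono powr_mono2') auto
  also have "\<dots> = a powr p + b powr p"
    using ab by (simp add: powr_diff)
  finally show ?thesis .
qed (use assms in auto)

text \<open>For \<open>a < 1\<close> the integrand is unbounded near 0, so integrability is not
  automatic. It comes from the gauge integral, since a nonnegative gauge-integrable function is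
  absolutely integrable; Borel measurability then allows the passage from the completed measure to
  \<open>lborel\<close>.\<close>

lemma set_lborel_integral_powr:
  fixes a x :: real
  assumes "0 < a" "0 \<le> x"
  shows "set_integrable lborel {0..x} (\<lambda>u. u powr (a - 1))"
    and "(LBINT u:{0..x}. u powr (a - 1)) = x powr a / a"
proof -
  have I: "((\<lambda>u. u powr (a - 1)) has_integral x powr a / a) {0..x}"
    using has_integral_powr_from_0[of "a - 1" x] assms by simp
  have "(\<lambda>u. u powr (a - 1)) absolutely_integrable_on {0..x}"
    using I by (intro nonnegative_absolutely_integrable_1) auto
  then show S: "set_integrable lborel {0..x} (\<lambda>u. u powr (a - 1))"
    unfolding set_integrable_def by (subst (asm) integrable_completion) auto
  show "(LBINT u:{0..x}. u powr (a - 1)) = x powr a / a"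
    using set_borel_integral_eq_integral(2)[OF S] I by (simp add: integral_unique)
qed

text \<open>The condition \<open>1 \<le> b\<close> makes the exponent \<open>b - 1\<close>
  nonnegative, so the second factor of the integrand is at most 1 and minimal at
  \<open>u = x\<close>. What is left integrates to \<open>x powr a / a\<close>, which explains the
  factor \<open>a\<close>.\<close>

lemma incomplete_Beta_bounds:
  fixes a b x :: real
  assumes a: "0 < a" and b: "1 \<le> b" and x: "0 \<le> x" "x \<le> 1"
  shows "x powr a * (1 - x) powr (b - 1) \<le> a * incomplete_Beta a b x"
    and "a * incomplete_Beta a b x \<le> x powr a"
proof -
  note P = set_lborel_integral_powr[OF a x(1)]
  have S: "set_integrable lborel {0..x} (\<lambda>u. u powr (a - 1) * (1 - u) powr (b - 1))"
    using P(1)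
  proof (rule set_integrable_bound)
    show "set_borel_measurable lborel {0..x} (\<lambda>u. u powr (a - 1) * (1 - u) powr (b - 1))"
      unfolding set_borel_measurable_def by measurable
    show "AE u in lborel. u \<in> {0..x} \<longrightarrow>
        norm (u powr (a - 1) * (1 - u) powr (b - 1)) \<le> norm (u powr (a - 1))"
      using b x by (intro AE_I2) (auto intro!: mult_left_le powr_le1)
  qed
  have "(LBINT u:{0..x}. u powr (a - 1) * (1 - x) powr (b - 1)) \<le> incomplete_Beta a b x"
    unfolding incomplete_Beta_def
    using P(1) S b x by (intro set_integral_mono) (auto intro!: mult_left_mono powr_mono2)
  then have "x powr a / a * (1 - x) powr (b - 1) \<le> incomplete_Beta a b x"
    by (simp add: P(2))
  then show "x powr a * (1 - x) powr (b - 1) \<le> a * incomplete_Beta a b x"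
    using a by (simp add: field_simps)
  have "incomplete_Beta a b x \<le> (LBINT u:{0..x}. u powr (a - 1))"
    unfolding incomplete_Beta_def
    using P(1) S b x by (intro set_integral_mono) (auto intro!: mult_left_le powr_le1)
  then have "incomplete_Beta a b x \<le> x powr a / a"
    by (simp add: P(2))
  then show "a * incomplete_Beta a b x \<le> x powr a"
    using a by (simp add: field_simps)
qed

text \<open>Moving the variable endpoint into the integrand as an indicator leaves the integral over
  one variable of a jointly measurable function of two, which is measurable in the other.\<close>

lemma borel_measurable_incomplete_Beta [measurable]:
  "incomplete_Beta a b \<in> borel_measurable borel"
proof -
  have "(\<lambda>x. \<integral>u. (if 0 \<le> u \<and> u \<le> x then 1 else 0) * (u powr (a - 1) * (1 - u) powr (b - 1)) \<partial>lborel)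
      \<in> borel_measurable borel"
    by measurable
  also have "(\<lambda>x. \<integral>u. (if 0 \<le> u \<and> u \<le> x then 1 else 0) * (u powr (a - 1) * (1 - u) powr (b - 1)) \<partial>lborel)
      = incomplete_Beta a b"
    unfolding incomplete_Beta_def set_lebesgue_integral_def
    by (intro ext Bochner_Integration.integral_cong) (auto simp: indicator_def)
  finally show ?thesis .
qed

lemma powr_times_incomplete_Beta_bounds:
  fixes p x y :: real
  assumes p: "0 < p" and xy: "0 \<le> x" "x \<le> y"
  shows "x powr p * (y - x) powr p \<le> p * (y powr (2 * p) * incomplete_Beta p (1 + p) (x / y))"
    and "p * (y powr (2 * p) * incomplete_Beta p (1 + p) (x / y)) \<le> x powr p * y powr p"
proof -
  have "x powr p * (y - x) powr p \<le> p * (y powr (2 * p) * incomplete_Beta p (1 + p) (x / y))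
    \<and> p * (y powr (2 * p) * incomplete_Beta p (1 + p) (x / y)) \<le> x powr p * y powr p"
  \<comment> \<open>Here \<open>x\<close> is 0 too, and \<open>0 powr p = 0\<close> makes all three
    quantities vanish, whatever the value of the quotient \<open>x / y\<close>.\<close>
  proof (cases "y = 0")
    case False
    with xy have y: "0 < y" by auto
    \<comment> \<open>The prefactor supplies one \<open>y powr p\<close> for each of
      \<open>x / y\<close> and \<open>1 - x / y\<close>, turning them into \<open>x\<close> and
      \<open>y - x\<close>.\<close>
    have sq: "y powr (2 * p) = y powr p * y powr p"
      by (simp flip: powr_add)
    have x: "(x / y) powr p * y powr p = x powr p"
      using xy y by (simp add: powr_divide)
    have "(1 - x / y) * y = y - x"
      using y by (simp add: field_simps)
    then have d: "(1 - x / y) powr p * y powr p = (y - x) powr p"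
      using xy y by (simp flip: powr_mult)
    note B = incomplete_Beta_bounds[of p "1 + p" "x / y"]
    have "x powr p * (y - x) powr p = y powr (2 * p) * ((x / y) powr p * (1 - x / y) powr (1 + p - 1))"
      unfolding sq x[symmetric] d[symmetric] by (simp add: algebra_simps)
    also have "\<dots> \<le> y powr (2 * p) * (p * incomplete_Beta p (1 + p) (x / y))"
      using p xy y by (intro mult_left_mono B) auto
    finally have 1: "x powr p * (y - x) powr p \<le> \<dots>" .
    have "y powr (2 * p) * (p * incomplete_Beta p (1 + p) (x / y)) \<le> y powr (2 * p) * (x / y) powr p"
      using p xy y by (intro mult_left_mono B) auto
    also have "\<dots> = x powr p * y powr p"
      unfolding sq x[symmetric] by (simp add: algebra_simps)
    finally show ?thesis
      using 1 by (simp add: algebra_simps)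
  qed (use xy in auto)
  then show "x powr p * (y - x) powr p \<le> p * (y powr (2 * p) * incomplete_Beta p (1 + p) (x / y))"
    and "p * (y powr (2 * p) * incomplete_Beta p (1 + p) (x / y)) \<le> x powr p * y powr p"
    by auto
qed

text \<open>A constant is negligible against a function tending to infinity, so \<open>g\<close> and
  \<open>g + C\<close> are equivalent and squeeze \<open>h\<close>.\<close>

lemma asymp_equiv_of_bounded_difference:
  fixes g h :: "'b \<Rightarrow> real"
  assumes g: "filterlim g at_top F"
    and gh: "\<forall>\<^sub>F t in F. g t \<le> h t \<and> h t \<le> g t + C"
  shows "h \<sim>[F] g"
proof -
  have "eventually (\<lambda>t. 0 < g t) F"
    using g by (simp add: filterlim_at_top_dense)
  then have "eventually (\<lambda>t. g t \<noteq> 0) F"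
    by eventually_elim simp
  then have "(\<lambda>_. C) \<in> o[F](g)"
    using g by (intro smalloI_tendsto tendsto_divide_0[OF tendsto_const] filterlim_at_top_imp_at_infinity)
  then have "(\<lambda>t. g t + C) \<sim>[F] g"
    by (simp add: asymp_equiv_add_right)
  then show ?thesis
    using gh by (intro asymp_equiv_sandwich_real[of g F g "\<lambda>t. g t + C" h]) auto
qed

section \<open>Product moments from independent and stationary increments\<close>

context levy_process
begin

lemma indep_var_increments:
  assumes "0 < s" "0 < h"
  shows "indep_var borel (\<lambda>\<omega>. X s \<omega> - X 0 \<omega>) borel (\<lambda>\<omega>. X (s + h) \<omega> - X s \<omega>)"
proof -
  define \<tau> :: "nat \<Rightarrow> real" where "\<tau> = (\<lambda>i. if i = 0 then 0 else if i = 1 then s else s + h)"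
  have "indep_vars (\<lambda>_. borel) (\<lambda>i \<omega>. X (\<tau> (Suc i)) \<omega> - X (\<tau> i) \<omega>) {..<2}"
    using assms by (intro indep_increments) (auto simp: \<tau>_def)
  also have "{..<2} = insert 0 {1::nat}" by auto
  finally show ?thesis
    \<comment> \<open>The sum over a singleton is the second increment itself, so this converts
      family independence into independence of a pair.\<close>
    using indep_vars_sum[of "{1::nat}" 0 "\<lambda>i \<omega>. X (\<tau> (Suc i)) \<omega> - X (\<tau> i) \<omega>"]
    by (simp add: \<tau>_def)
qed

lemma
  fixes \<phi> :: "real \<Rightarrow> real"
  assumes "0 \<le> t" "0 \<le> h" and [measurable]: "\<phi> \<in> borel_measurable borel"
  shows integrable_increment_iff:
      "integrable M (\<lambda>\<omega>. \<phi> (X (t + h) \<omega> - X t \<omega>)) \<longleftrightarrow> integrable M (\<lambda>\<omega>. \<phi> (X h \<omega>))"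
    and expectation_increment:
      "expectation (\<lambda>\<omega>. \<phi> (X (t + h) \<omega> - X t \<omega>)) = expectation (\<lambda>\<omega>. \<phi> (X h \<omega>))"
proof -
  have [measurable]: "random_variable borel (X (t + h))" "random_variable borel (X t)"
    "random_variable borel (X h)" "random_variable borel (X 0)"
    using assms by (auto intro: random_variable_X)
  \<comment> \<open>Stationarity compares with \<open>X h - X 0\<close>, and \<open>X 0\<close>
    vanishes only almost surely.\<close>
  have ae: "AE \<omega> in M. \<phi> (X h \<omega> - X 0 \<omega>) = \<phi> (X h \<omega>)"
    using X_0 by eventually_elim simp
  have "integrable M (\<lambda>\<omega>. \<phi> (X (t + h) \<omega> - X t \<omega>))
      \<longleftrightarrow> integrable (distr M borel (\<lambda>\<omega>. X (t + h) \<omega> - X t \<omega>)) \<phi>"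
    by (subst integrable_distr_eq) auto
  also have "\<dots> \<longleftrightarrow> integrable M (\<lambda>\<omega>. \<phi> (X h \<omega> - X 0 \<omega>))"
    unfolding stationary_increments[OF assms(1,2)] by (subst integrable_distr_eq) auto
  also have "\<dots> \<longleftrightarrow> integrable M (\<lambda>\<omega>. \<phi> (X h \<omega>))"
    using ae by (intro integrable_cong_AE) auto
  finally show "integrable M (\<lambda>\<omega>. \<phi> (X (t + h) \<omega> - X t \<omega>)) \<longleftrightarrow> integrable M (\<lambda>\<omega>. \<phi> (X h \<omega>))" .
  have "expectation (\<lambda>\<omega>. \<phi> (X (t + h) \<omega> - X t \<omega>))
      = integral\<^sup>L (distr M borel (\<lambda>\<omega>. X (t + h) \<omega> - X t \<omega>)) \<phi>"
    by (subst integral_distr) auto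
  also have "\<dots> = expectation (\<lambda>\<omega>. \<phi> (X h \<omega> - X 0 \<omega>))"
    unfolding stationary_increments[OF assms(1,2)] by (subst integral_distr) auto
  also have "\<dots> = expectation (\<lambda>\<omega>. \<phi> (X h \<omega>))"
    using ae by (intro integral_cong_AE) auto
  finally show "expectation (\<lambda>\<omega>. \<phi> (X (t + h) \<omega> - X t \<omega>)) = expectation (\<lambda>\<omega>. \<phi> (X h \<omega>))" .
qed

text \<open>Independence is available for increments only, so \<open>X s\<close> is first replaced
  by \<open>X s - X 0\<close>. The expectation then factors, and stationarity removes the starting
  times.\<close>

lemma expectation_times_increment:
  fixes \<phi> \<psi> :: "real \<Rightarrow> real"
  assumes "0 < s" "0 < h"
    and [measurable]: "\<phi> \<in> borel_measurable borel" "\<psi> \<in> borel_measurable borel"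
    and "integrable M (\<lambda>\<omega>. \<phi> (X s \<omega>))" "integrable M (\<lambda>\<omega>. \<psi> (X h \<omega>))"
  shows "expectation (\<lambda>\<omega>. \<phi> (X s \<omega>) * \<psi> (X (s + h) \<omega> - X s \<omega>))
       = expectation (\<lambda>\<omega>. \<phi> (X s \<omega>)) * expectation (\<lambda>\<omega>. \<psi> (X h \<omega>))"
proof -
  have [measurable]: "random_variable borel (X (s + h))" "random_variable borel (X s)"
    "random_variable borel (X 0)"
    using assms by (auto intro: random_variable_X)
  have ind: "indep_var borel (\<lambda>\<omega>. \<phi> (X s \<omega> - X 0 \<omega>)) borel (\<lambda>\<omega>. \<psi> (X (s + h) \<omega> - X s \<omega>))"
    using indep_var_compose[OF indep_var_increments[OF assms(1,2)] assms(3,4)]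
    by (simp add: o_def)
  have "expectation (\<lambda>\<omega>. \<phi> (X s \<omega>) * \<psi> (X (s + h) \<omega> - X s \<omega>))
      = expectation (\<lambda>\<omega>. \<phi> (X s \<omega> - X 0 \<omega>) * \<psi> (X (s + h) \<omega> - X s \<omega>))"
    using X_0 by (intro integral_cong_AE) auto
  also have "\<dots> = expectation (\<lambda>\<omega>. \<phi> (X s \<omega> - X 0 \<omega>)) * expectation (\<lambda>\<omega>. \<psi> (X (s + h) \<omega> - X s \<omega>))"
    using assms integrable_increment_iff[of 0 s \<phi>] integrable_increment_iff[of s h \<psi>]
    by (intro indep_var_lebesgue_integral ind) auto
  also have "\<dots> = expectation (\<lambda>\<omega>. \<phi> (X s \<omega>)) * expectation (\<lambda>\<omega>. \<psi> (X h \<omega>))"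
    using assms expectation_increment[of 0 s \<phi>] expectation_increment[of s h \<psi>] by simp
  finally show ?thesis .
qed

end

section \<open>Degeneracy and moment bounds for the subordinator\<close>

context subordinator
begin

lemma AE_nonneg_mono:
  assumes "0 \<le> s" "s \<le> t"
  shows "AE \<omega> in M. 0 \<le> D s \<omega> \<and> D s \<omega> \<le> D t \<omega>"
  using nondecreasing X_0
proof eventually_elim
  case (elim \<omega>)
  then have "D 0 \<omega> \<le> D s \<omega>" "D s \<omega> \<le> D t \<omega>"
    using assms by blast+
  then show ?case using elim by simp
qed

text \<open>The exponent \<open>f\<close> is the same at all times: vanishing at one positive time
  forces \<open>f 1 = 0\<close>, hence \<open>exp (- D t)\<close> has expectation 1 for every
  \<open>t\<close>. As it is almost surely at most 1, it equals 1 almost surely.\<close>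

lemma AE_eq_0_at_all_times:
  assumes s: "0 < s" "AE \<omega> in M. D s \<omega> = 0" and t: "0 \<le> t"
  shows "AE \<omega> in M. D t \<omega> = 0"
proof -
  have [measurable]: "random_variable borel (D r)" if "0 \<le> r" for r
    using that by (rule random_variable_X)
  have "expectation (\<lambda>\<omega>. exp (- (1 * D s \<omega>))) = expectation (\<lambda>_. 1)"
    using s by (intro integral_cong_AE) auto
  then have "f 1 = 0"
    using laplace[of s 1] s by (simp add: prob_space)
  then have E: "expectation (\<lambda>\<omega>. exp (- D t \<omega>)) = 1"
    using laplace[of t 1] t by simp
  have nn: "AE \<omega> in M. 0 \<le> D t \<omega>"
    using AE_nonneg_mono[of t t] t by auto
  have int: "integrable M (\<lambda>\<omega>. exp (- D t \<omega>))"
    using nn t by (intro integrable_const_bound[of _ 1]) auto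
  have "AE \<omega> in M. 1 - exp (- D t \<omega>) = 0"
  proof (subst integral_nonneg_eq_0_iff_AE[symmetric])
    show "expectation (\<lambda>\<omega>. 1 - exp (- D t \<omega>)) = 0"
      using int E by (simp add: prob_space)
  qed (use int nn in auto)
  then show ?thesis by simp
qed

text \<open>The gap \<open>h\<close> stands for \<open>t - s\<close>. What matters for the
  asymptotics is that the error term in the last bound does not depend on \<open>h\<close>.\<close>

lemma expectation_powr_bounds:
  assumes p: "0 < p" "p < 1" and s: "0 < s" and h: "0 < h"
    and moments: "\<And>\<rho> t. 0 < \<rho> \<Longrightarrow> 0 \<le> t \<Longrightarrow> integrable M (\<lambda>\<omega>. D t \<omega> powr \<rho>)"
  defines "g \<equiv> expectation (\<lambda>\<omega>. D s \<omega> powr p) * expectation (\<lambda>\<omega>. D h \<omega> powr p)"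
    and "B \<equiv> p * expectation (\<lambda>\<omega>. D (s + h) \<omega> powr (2 * p)
                  * incomplete_Beta p (1 + p) (D s \<omega> / D (s + h) \<omega>))"
    and "E \<equiv> expectation (\<lambda>\<omega>. D s \<omega> powr p * D (s + h) \<omega> powr p)"
  shows "g \<le> B" "B \<le> E" "E \<le> g + expectation (\<lambda>\<omega>. D s \<omega> powr (2 * p))"
proof -
  define t where "t = s + h"
  have [measurable]: "random_variable borel (D s)" "random_variable borel (D t)"
    using s h by (auto simp: t_def intro: random_variable_X)
  have ord: "AE \<omega> in M. 0 \<le> D s \<omega> \<and> D s \<omega> \<le> D t \<omega>"
    using s h by (intro AE_nonneg_mono) (auto simp: t_def)
  have double: "y powr p * y powr p = y powr (2 * p)" for y :: real
    by (simp flip: powr_add)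
  let ?b = "\<lambda>\<omega>. p * (D t \<omega> powr (2 * p) * incomplete_Beta p (1 + p) (D s \<omega> / D t \<omega>))"
  let ?l = "\<lambda>\<omega>. D s \<omega> powr p * (D t \<omega> - D s \<omega>) powr p"
  let ?e = "\<lambda>\<omega>. D s \<omega> powr p * D t \<omega> powr p"
  \<comment> \<open>With the product of expectations written as one expectation, all comparisons
    reduce to almost sure inequalities between random variables.\<close>
  have g: "g = expectation ?l"
    unfolding g_def t_def using s h p moments
    by (intro expectation_times_increment[symmetric]) auto
  have lb: "AE \<omega> in M. ?l \<omega> \<le> ?b \<omega>" and be: "AE \<omega> in M. ?b \<omega> \<le> ?e \<omega>"
    using ord by (eventually_elim, use p powr_times_incomplete_Beta_bounds in auto)+
  have nonneg: "AE \<omega> in M. 0 \<le> ?b \<omega>"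
    using lb by eventually_elim (rule order_trans[rotated], auto)
  have int2: "integrable M (\<lambda>\<omega>. D r \<omega> powr (2 * p))" if "0 \<le> r" for r
    using moments[of "2 * p" r] p that by auto
  \<comment> \<open>Integrability descends along the chain of almost surely nonnegative variables:
    \<open>?e\<close> is dominated by \<open>D t powr (2 * p)\<close> because
    \<open>D s \<le> D t\<close>, then \<open>?b\<close> by \<open>?e\<close> and \<open>?l\<close>
    by \<open>?b\<close>.\<close>
  have int_e: "integrable M ?e"
  proof (rule Bochner_Integration.integrable_bound)
    show "AE \<omega> in M. norm (?e \<omega>) \<le> norm (D t \<omega> powr (2 * p))"
      using ord
    proof eventually_elim
      case (elim \<omega>)
      then have "?e \<omega> \<le> D t \<omega> powr p * D t \<omega> powr p"
        using p by (intro mult_right_mono powr_mono2) auto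
      then show ?case by (simp add: double)
    qed
    show "integrable M (\<lambda>\<omega>. D t \<omega> powr (2 * p))"
      using s h by (intro int2) (simp add: t_def)
  qed measurable
  have int_b: "integrable M ?b"
    proof (rule Bochner_Integration.integrable_bound[OF int_e])
    show "AE \<omega> in M. norm (?b \<omega>) \<le> norm (?e \<omega>)"
      using nonneg be by eventually_elim simp
  qed measurable
  have int_l: "integrable M ?l"
    proof (rule Bochner_Integration.integrable_bound[OF int_b])
    show "AE \<omega> in M. norm (?l \<omega>) \<le> norm (?b \<omega>)"
      using lb nonneg by eventually_elim simp
  qed measurable
  have B: "B = expectation ?b" and E: "E = expectation ?e"
    by (simp_all add: B_def E_def t_def)
  show "g \<le> B"
    unfolding g B using lb by (intro integral_mono_AE int_l int_b) auto
  show "B \<le> E"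
    unfolding B E by (intro integral_mono_AE int_b int_e be)
  have "E \<le> expectation (\<lambda>\<omega>. ?l \<omega> + D s \<omega> powr (2 * p))"
    unfolding E
  proof (intro integral_mono_AE int_e Bochner_Integration.integrable_add int_l int2)
    show "AE \<omega> in M. ?e \<omega> \<le> ?l \<omega> + D s \<omega> powr (2 * p)"
      using ord
    proof eventually_elim
      case (elim \<omega>)
      then have "D t \<omega> powr p \<le> (D t \<omega> - D s \<omega>) powr p + D s \<omega> powr p"
        using powr_add_le_add_powr[of "D t \<omega> - D s \<omega>" "D s \<omega>" p] p by simp
      then have "?e \<omega> \<le> D s \<omega> powr p * ((D t \<omega> - D s \<omega>) powr p + D s \<omega> powr p)"
        by (intro mult_left_mono) auto
      then show ?case by (simp add: distrib_left double)
    qed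
  qed (use s in auto)
  also have "\<dots> = g + expectation (\<lambda>\<omega>. D s \<omega> powr (2 * p))"
    unfolding g using int_l int2 s by simp
  finally show "E \<le> g + expectation (\<lambda>\<omega>. D s \<omega> powr (2 * p))" .
qed

end

section \<open>Divergence of the comparison function and the two equivalences\<close>

theorem theorem3p3:
  fixes M :: "'a measure" and D :: "real \<Rightarrow> 'a \<Rightarrow> real" and f :: "real \<Rightarrow> real"
    and \<beta> s :: real
  assumes "0 < \<beta>" and "\<beta> < 1" and "0 < s"
    and "subordinator M D f"
    and "\<And>\<rho> t. 0 < \<rho> \<Longrightarrow> 0 \<le> t \<Longrightarrow> integrable M (\<lambda>\<omega>. D t \<omega> powr \<rho>)"
    and "filterlim (\<lambda>t. \<integral>\<omega>. D t \<omega> powr \<beta> \<partial>M) at_top at_top"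
  shows "((\<lambda>t. \<integral>\<omega>. D s \<omega> powr \<beta> * D t \<omega> powr \<beta> \<partial>M)
           \<sim>[at_top] (\<lambda>t. (\<integral>\<omega>. D s \<omega> powr \<beta> \<partial>M) * (\<integral>\<omega>. D (t - s) \<omega> powr \<beta> \<partial>M)))
         \<and> ((\<lambda>t. \<beta> * (\<integral>\<omega>. D t \<omega> powr (2 * \<beta>)
                      * incomplete_Beta \<beta> (1 + \<beta>) (D s \<omega> / D t \<omega>) \<partial>M))
           \<sim>[at_top] (\<lambda>t. (\<integral>\<omega>. D s \<omega> powr \<beta> \<partial>M) * (\<integral>\<omega>. D (t - s) \<omega> powr \<beta> \<partial>M)))"
proof -
  interpret subordinator M D f by fact
  let ?m = "\<lambda>t. expectation (\<lambda>\<omega>. D t \<omega> powr \<beta>)"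
  let ?C = "expectation (\<lambda>\<omega>. D s \<omega> powr (2 * \<beta>))"
  \<comment> \<open>The comparison function inherits divergence from \<open>?m (t - s)\<close> only
    if its constant factor \<open>?m s\<close> is positive.\<close>
  have "?m s \<noteq> 0"
  proof
    assume "?m s = 0"
    then have "AE \<omega> in M. D s \<omega> powr \<beta> = 0"
      using assms by (subst (asm) integral_nonneg_eq_0_iff_AE) auto
    then have "AE \<omega> in M. D s \<omega> = 0" by simp
    then have "AE \<omega> in M. D t \<omega> = 0" if "0 \<le> t" for t
      using AE_eq_0_at_all_times assms(3) that by blast
    then have "?m t = 0" if "0 \<le> t" for t
      using that by (intro integral_eq_zero_AE) auto
    moreover have "\<forall>\<^sub>F t in at_top. 0 < ?m t"
      using assms(6) by (simp add: filterlim_at_top_dense)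
    \<comment> \<open>Eventually \<open>?m t\<close> is positive although it is 0 for every
      \<open>t \<ge> 0\<close>, so all large \<open>t\<close> would have to be negative.\<close>
    ultimately have "\<forall>\<^sub>F t in at_top. (t::real) < 0"
      by (auto elim!: eventually_mono simp: not_le[symmetric])
    then show False
      using eventually_ge_at_top[of "0::real"] eventually_conj[of "\<lambda>t::real. t < 0" at_top "\<lambda>t. 0 \<le> t"]
      by (auto simp: eventually_False simp flip: not_le)
  qed
  then have "0 < ?m s"
    by (simp add: less_le)
  moreover have "filterlim (\<lambda>t. ?m (t - s)) at_top at_top"
    using filterlim_compose[OF assms(6) filterlim_tendsto_add_at_top[OF tendsto_const[of "- s"] filterlim_ident]]
    by simp
  ultimately have lim: "filterlim (\<lambda>t. ?m s * ?m (t - s)) at_top at_top"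
    by (intro filterlim_tendsto_pos_mult_at_top[OF tendsto_const])
  have bounds: "?m s * ?m (t - s) \<le> \<beta> * expectation (\<lambda>\<omega>. D t \<omega> powr (2 * \<beta>)
        * incomplete_Beta \<beta> (1 + \<beta>) (D s \<omega> / D t \<omega>))"
      "\<beta> * expectation (\<lambda>\<omega>. D t \<omega> powr (2 * \<beta>) * incomplete_Beta \<beta> (1 + \<beta>) (D s \<omega> / D t \<omega>))
        \<le> expectation (\<lambda>\<omega>. D s \<omega> powr \<beta> * D t \<omega> powr \<beta>)"
      "expectation (\<lambda>\<omega>. D s \<omega> powr \<beta> * D t \<omega> powr \<beta>) \<le> ?m s * ?m (t - s) + ?C"
    if "s < t" for t
    using expectation_powr_bounds[of \<beta> s "t - s"] assms(1-3,5) that by simp_all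
  show ?thesis
    \<comment> \<open>Both left-hand sides lie between the comparison function and its shift by
      \<open>?C\<close>, each by chaining two of the three inequalities where needed. They hold for
      \<open>s < t\<close>, hence eventually.\<close>
    by (intro conjI asymp_equiv_of_bounded_difference[where C = ?C] lim
        eventually_mono[OF eventually_gt_at_top[of s]])
      (use bounds in force)+
qed

end
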